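(* Let $d\ge 2$, $e\ge 1$, $n\ge 1$ be integers, and suppose that $[n]$ is the disjoint union of sets $X_1,\ldots,X_e$. Let $\mathcal{D}=\{(A_i^{(1)},\ldots,A_i^{(d)})\}_{1\le i\le m}$ be a weak Bollobás system of $d$-partitions of $[n]$. Let $S=\bigcup_{i=1}^m\bigcup_{r=1}^d A_i^{(r)}$ and $s_k=|S\cap X_k|$ for $k\in[e]$. Then $$\sum_{i=1}^{m}\left(\prod_{k=1}^{e}\binom{\sum_{r=1}^{d}|A_i^{(r)}\cap X_k|}{|A_i^{(1)}\cap X_k|,\ldots,|A_{i}^{(d)}\cap X_{k}|}\right)^{-1}\le \prod_{k=1}^{e}\binom{s_k+d-1}{d-1}.$$ Moreover, the upper bound is tight: for every $n\ge 1$, $d\ge 2$ and every decomposition of $[n]$ as a disjoint union of sets $X_1,\ldots,X_e$, there exists a weak Bollobás system of $d$-partitions of $[n]$ with $s_k=|X_k|$ for all $k\in[e]$ for which equality holds.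
   Context: For a positive integer $n$, $[n]=\{1,\dots,n\}$. For $d\ge 2$, a $d$-partition of $[n]$ is a tuple $(A^{(1)},\dots,A^{(d)})$ of (possibly empty) pairwise disjoint subsets of $[n]$; their union need not be all of $[n]$. A family $\{(A_i^{(1)},\dots,A_i^{(d)})\}_{1\le i\le m}$ of $d$-partitions of $[n]$ is a weak Bollobás system if for any $1\le i<j\le m$ there exist $1\le p<q\le d$ such that $A_i^{(p)}\cap A_j^{(q)}\ne\emptyset$ or $A_j^{(p)}\cap A_i^{(q)}\ne\emptyset$. For non-negative integers $a_1,\ldots,a_d$ with $a_1+\cdots+a_d\le N$, $\binom{N}{a_1,\ldots,a_d}=\frac{N!}{a_1!\cdots a_d!(N-a_1-\cdots-a_d)!}$. *)

theory Defs
  imports Complex_Main "HOL-Library.Disjoint_Sets"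
begin

text \<open>
  A tuple \<open>(P\<^sup>(\<^sup>1\<^sup>), \<dots>, P\<^sup>(\<^sup>d\<^sup>))\<close> is a function whose values matter only on \<open>{1..d}\<close>;
  similarly, a family of \<open>m\<close> tuples is a function \<open>A\<close> with \<open>A i r\<close> standing for
  \<open>A\<^sub>i\<^sup>(\<^sup>r\<^sup>)\<close>, used only for \<open>i \<in> {1..m}\<close> and \<open>r \<in> {1..d}\<close>.
\<close>

text \<open>The parts may be empty and need not cover \<open>{1..n}\<close>.\<close>

definition d_partition :: "nat \<Rightarrow> nat \<Rightarrow> (nat \<Rightarrow> nat set) \<Rightarrow> bool" where
  "d_partition d n P \<longleftrightarrow>
     (\<forall>r\<in>{1..d}. P r \<subseteq> {1..n}) \<and> disjoint_family_on P {1..d}"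

definition weak_bollobas :: "nat \<Rightarrow> nat \<Rightarrow> nat \<Rightarrow> (nat \<Rightarrow> nat \<Rightarrow> nat set) \<Rightarrow> bool" where
  "weak_bollobas d n m A \<longleftrightarrow>
     (\<forall>i\<in>{1..m}. d_partition d n (A i)) \<and>
     (\<forall>i j. 1 \<le> i \<and> i < j \<and> j \<le> m \<longrightarrow>
        (\<exists>p q. 1 \<le> p \<and> p < q \<and> q \<le> d \<and>
           (A i p \<inter> A j q \<noteq> {} \<or> A j p \<inter> A i q \<noteq> {})))"

definition family_support :: "nat \<Rightarrow> nat \<Rightarrow> (nat \<Rightarrow> nat \<Rightarrow> nat set) \<Rightarrow> nat set" where
  "family_support d m A = (\<Union>i\<in>{1..m}. \<Union>r\<in>{1..d}. A i r)"

text \<open>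
  Meaningful only if \<open>(\<Sum>r=1..d. a r) \<le> N\<close>, since the subtraction is on natural numbers.
\<close>

definition multinomial :: "nat \<Rightarrow> nat \<Rightarrow> (nat \<Rightarrow> nat) \<Rightarrow> real" where
  "multinomial N d a = fact N / ((\<Prod>r=1..d. fact (a r)) * fact (N - (\<Sum>r=1..d. a r)))"

end

theory Submission
  imports Defs
begin

text \<open>
  A colouring of the ground set with \<open>d\<close> colours extends a tuple of disjoint parts if it gives
  colour \<open>r\<close> to every point of the \<open>r\<close>-th part. If two tuples satisfy the crossing condition of a
  weak Bollobas system, some point lies in parts with different indices, so no colouring extends both.
  Hence, for \<^emph>\<open>any\<close> probability distribution on colourings, the probabilities that a random
  colouring extends \<open>A\<^sub>i\<close> add up to at most 1.

  The distribution that gives the theorem comes from Polya's urn, run independently on each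
  block \<open>X\<^sub>k\<close>: the urn starts with one ball of each colour, and the points of the block
  successively draw a ball and put it back together with another ball of the same colour.
  The urn is exchangeable: a prescribed partial colouring of a block with \<open>a\<^sub>r\<close> points
  of colour \<open>r\<close>, \<open>a\<close> points in total, has probability
  \[ \frac{(d-1)!\, a_1! \cdots a_d!}{(a+d-1)!}
     = \binom{a}{a_1,\ldots,a_d}^{-1} \binom{a+d-1}{d-1}^{-1}. \]
  In exact form this is \<open>sum_block_weight_extensions\<close>, and it rests on
  the one-step identity \<open>sum_urn_weight_step\<close>. Since a tuple of the
  system has \<open>a \<le> s\<^sub>k\<close> points in block \<open>k\<close>, the second binomial coefficient is at most
  \<open>(s\<^sub>k + d - 1) choose (d - 1)\<close>, and the inequality follows.

  Equality holds for the system of all colourings of \<open>{1..n}\<close>: there the extension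
  probabilities add up to exactly 1, and every tuple has \<open>a = s\<^sub>k = |X\<^sub>k|\<close>.
\<close>

section \<open>The urn weight\<close>

text \<open>
  The probability that Polya's urn with \<open>d\<close> colours produces one given sequence of draws
  containing each colour \<open>r\<close> exactly \<open>a r\<close> times; it does not depend on the order of the draws.
\<close>

definition urn_weight :: "nat \<Rightarrow> (nat \<Rightarrow> nat) \<Rightarrow> real" where
  "urn_weight d a = fact (d - 1) * (\<Prod>r=1..d. fact (a r)) / fact ((\<Sum>r=1..d. a r) + d - 1)"

text \<open>
  With one independent urn per block \<open>X k\<close>, the probability that a random colouring extends
  the tuple \<open>P\<close> of disjoint parts.
\<close>

definition block_weight :: "nat \<Rightarrow> nat \<Rightarrow> (nat \<Rightarrow> nat set) \<Rightarrow> (nat \<Rightarrow> nat set) \<Rightarrow> real" where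
  "block_weight d e X P = (\<Prod>k=1..e. urn_weight d (\<lambda>r. card (P r \<inter> X k)))"

lemma block_weight_nonneg: "0 \<le> block_weight d e X P"
  unfolding block_weight_def urn_weight_def
  by (intro prod_nonneg divide_nonneg_nonneg mult_nonneg_nonneg) auto

lemma block_weight_cong:
  assumes "\<And>r. r \<in> {1..d} \<Longrightarrow> P r = Q r"
  shows "block_weight d e X P = block_weight d e X Q"
  unfolding block_weight_def urn_weight_def using assms by simp

lemma block_weight_empty: "block_weight d e X (\<lambda>_. {}) = 1"
  unfolding block_weight_def urn_weight_def by simp

text \<open>
  One draw from the urn: after \<open>a\<^sub>r\<close> draws of each colour \<open>r\<close>, with \<open>N\<close> draws in total, the urn holds
  \<open>a\<^sub>r + 1\<close> balls of colour \<open>r\<close> among \<open>N + d\<close>, so the conditional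
  probabilities of the next colour add up to 1.
\<close>

lemma sum_urn_weight_step:
  assumes "d \<ge> 1"
  shows "(\<Sum>r=1..d. urn_weight d (a(r := Suc (a r)))) = urn_weight d a"
proof -
  define N where "N = (\<Sum>r=1..d. a r)"
  have fact_step: "(fact (N + d) :: real) = real (N + d) * fact (N + d - 1)"
    using assms by (subst fact_reduce) simp_all
  have step: "urn_weight d (a(r := Suc (a r))) = real (Suc (a r)) / real (N + d) * urn_weight d a"
    if r: "r \<in> {1..d}" for r
  proof -
    have s: "(\<Sum>i=1..d. (a(r := Suc (a r))) i) = Suc N"
    proof -
      have "(\<Sum>i=1..d. (a(r := Suc (a r))) i) = Suc (a r) + (\<Sum>i\<in>{1..d}-{r}. a i)"
        using r by (subst sum.remove[of _ r]) (auto intro!: sum.cong)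
      also have "\<dots> = Suc N"
        unfolding N_def using r by (subst (2) sum.remove[of _ r]) auto
      finally show ?thesis .
    qed
    have p: "(\<Prod>i=1..d. fact ((a(r := Suc (a r))) i) :: real) = real (Suc (a r)) * (\<Prod>i=1..d. fact (a i))"
    proof -
      have "(\<Prod>i=1..d. fact ((a(r := Suc (a r))) i) :: real)
          = fact (Suc (a r)) * (\<Prod>i\<in>{1..d}-{r}. fact (a i))"
        using r by (subst prod.remove[of _ r]) (auto intro!: prod.cong)
      also have "\<dots> = real (Suc (a r)) * (\<Prod>i=1..d. fact (a i))"
        using r by (subst (2) prod.remove[of _ r]) auto
      finally show ?thesis .
    qed
    show ?thesis
      unfolding urn_weight_def s p N_def[symmetric] using fact_step by (simp add: mult_ac)
  qed
  have "(\<Sum>r=1..d. urn_weight d (a(r := Suc (a r))))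
      = (\<Sum>r=1..d. real (Suc (a r)) / real (N + d) * urn_weight d a)"
    using step by (intro sum.cong) auto
  also have "\<dots> = (\<Sum>r=1..d. real (Suc (a r))) / real (N + d) * urn_weight d a"
    by (simp only: sum_divide_distrib sum_distrib_right)
  also have "(\<Sum>r=1..d. real (Suc (a r))) = real (N + d)"
    unfolding N_def by (simp add: sum.distrib)
  also have "real (N + d) / real (N + d) * urn_weight d a = urn_weight d a"
    using assms by simp
  finally show ?thesis .
qed

text \<open>
  The binomial coefficient counts the vectors of colour multiplicities with the same total: the urn makes all of
  them equally likely, and given the multiplicities all arrangements are equally likely.
\<close>

lemma inverse_multinomial_eq_urn_weight:
  assumes "d \<ge> 1"
  shows "inverse (multinomial (\<Sum>r=1..d. a r) d a)
       = urn_weight d a * real (((\<Sum>r=1..d. a r) + d - 1) choose (d - 1))"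
proof -
  define N where "N = (\<Sum>r=1..d. a r)"
  have "real ((N + d - 1) choose (d - 1)) = fact (N + d - 1) / (fact (d - 1) * fact N)"
    using assms by (subst binomial_fact) auto
  then show ?thesis
    unfolding multinomial_def urn_weight_def N_def[symmetric] by (simp add: field_simps)
qed

lemma inverse_prod_multinomial_eq_block_weight:
  assumes "d \<ge> 1"
  shows "inverse (\<Prod>k=1..e.
           multinomial (\<Sum>r=1..d. card (P r \<inter> X k)) d (\<lambda>r. card (P r \<inter> X k)))
       = block_weight d e X P *
         (\<Prod>k=1..e. real (((\<Sum>r=1..d. card (P r \<inter> X k)) + d - 1) choose (d - 1)))"
  unfolding block_weight_def prod.distrib[symmetric] prod_inversef[symmetric] comp_def
  by (intro prod.cong refl inverse_multinomial_eq_urn_weight assms)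

text \<open>
  Colouring one further point \<open>x\<close> changes the weight of its own block only, so the urn step carries over
  to the product over all blocks.
\<close>

lemma sum_block_weight_insert:
  assumes "d \<ge> 1" and X: "disjoint_family_on X {1..e}" and x: "x \<in> (\<Union>k\<in>{1..e}. X k)"
    and fin: "\<And>r. r \<in> {1..d} \<Longrightarrow> finite (P r)" and new: "\<And>r. r \<in> {1..d} \<Longrightarrow> x \<notin> P r"
  shows "(\<Sum>r=1..d. block_weight d e X (P(r := insert x (P r)))) = block_weight d e X P"
proof -
  obtain k where k: "k \<in> {1..e}" "x \<in> X k"
    using x by blast
  have other: "x \<notin> X l" if "l \<in> {1..e}" "l \<noteq> k" for l
    using X k that unfolding disjoint_family_on_def by blast
  define rest where "rest = (\<Prod>l\<in>{1..e}-{k}. urn_weight d (\<lambda>r. card (P r \<inter> X l)))"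
  define a where "a = (\<lambda>r. card (P r \<inter> X k))"
  have step: "block_weight d e X (P(r := insert x (P r))) = urn_weight d (a(r := Suc (a r))) * rest"
    if r: "r \<in> {1..d}" for r
  proof -
    let ?Q = "P(r := insert x (P r))"
    have "(\<lambda>s. card (?Q s \<inter> X k)) = a(r := Suc (a r))"
      using r k fin[OF r] new[OF r] by (auto simp: a_def fun_eq_iff Int_insert_left)
    moreover have "(\<lambda>s. card (?Q s \<inter> X l)) = (\<lambda>s. card (P s \<inter> X l))" if "l \<in> {1..e}-{k}" for l
      using other[of l] that by (auto simp: fun_eq_iff Int_insert_left)
    ultimately show ?thesis
      unfolding block_weight_def rest_def using k(1) by (subst prod.remove[of _ k]) auto
  qed
  have "(\<Sum>r=1..d. block_weight d e X (P(r := insert x (P r))))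
      = (\<Sum>r=1..d. urn_weight d (a(r := Suc (a r)))) * rest"
    using step by (simp add: sum_distrib_right)
  also have "\<dots> = urn_weight d a * rest"
    by (simp only: sum_urn_weight_step[OF assms(1)])
  also have "\<dots> = block_weight d e X P"
    unfolding block_weight_def rest_def a_def using k(1) by (subst (2) prod.remove[of _ k]) auto
  finally show ?thesis .
qed

section \<open>Colourings extending a tuple\<close>

definition fibre :: "nat set \<Rightarrow> (nat \<Rightarrow> nat) \<Rightarrow> nat \<Rightarrow> nat set" where
  "fibre V f r = {x \<in> V. f x = r}"

definition extensions :: "nat \<Rightarrow> nat set \<Rightarrow> (nat \<Rightarrow> nat set) \<Rightarrow> (nat \<Rightarrow> nat) set" where
  "extensions d V P = {f \<in> V \<rightarrow>\<^sub>E {1..d}. \<forall>r\<in>{1..d}. \<forall>x\<in>P r. f x = r}"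

lemma finite_extensions: "finite V \<Longrightarrow> finite (extensions d V P)"
  unfolding extensions_def by (simp add: finite_PiE)

lemma extensions_empty: "extensions d V (\<lambda>_. {}) = V \<rightarrow>\<^sub>E {1..d}"
  unfolding extensions_def by simp

text \<open>
  The probability of a partial colouring is the total weight of its completions. The induction
  runs over the number of uncoloured points: some uncoloured point \<open>x\<close> is given each of
  the \<open>d\<close> colours, and the urn step collects the \<open>d\<close> resulting weights.
\<close>

lemma sum_block_weight_extensions:
  assumes "d \<ge> 1" and X: "disjoint_family_on X {1..e}"
    and "finite V" and V: "V \<subseteq> (\<Union>k\<in>{1..e}. X k)"
    and "\<And>r. r \<in> {1..d} \<Longrightarrow> P r \<subseteq> V" and "disjoint_family_on P {1..d}"
  shows "(\<Sum>f\<in>extensions d V P. block_weight d e X (fibre V f)) = block_weight d e X P"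
  using assms(5,6)
proof (induction "card (V - (\<Union>r\<in>{1..d}. P r))" arbitrary: P)
  case 0
  then have "V - (\<Union>r\<in>{1..d}. P r) = {}"
    using \<open>finite V\<close> by simp
  then have cover: "V = (\<Union>r\<in>{1..d}. P r)"
    using "0.prems"(1) by blast
  have uniq: "r = s" if "r \<in> {1..d}" "s \<in> {1..d}" "x \<in> P r" "x \<in> P s" for r s x
    using "0.prems"(2) that unfolding disjoint_family_on_def by blast
  \<comment> \<open>Every point is already coloured, so there is exactly one completion.\<close>
  define g where "g = restrict (\<lambda>x. THE r. r \<in> {1..d} \<and> x \<in> P r) V"
  have g: "g x = r" if "r \<in> {1..d}" "x \<in> P r" for x r
  proof -
    have "(THE s. s \<in> {1..d} \<and> x \<in> P s) = r"
      using that uniq by (intro the_equality) blast+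
    then show ?thesis
      using that "0.prems"(1) unfolding g_def by auto
  qed
  have "g \<in> V \<rightarrow>\<^sub>E {1..d}"
  proof (rule PiE_I)
    show "g x \<in> {1..d}" if x: "x \<in> V" for x
    proof -
      obtain r where "r \<in> {1..d}" "x \<in> P r"
        using x cover by blast
      then show ?thesis using g by metis
    qed
  qed (simp add: g_def)
  then have "g \<in> extensions d V P"
    unfolding extensions_def using g by blast
  moreover have "f = g" if f: "f \<in> extensions d V P" for f
  proof
    fix x
    show "f x = g x"
    proof (cases "x \<in> V")
      case True
      then obtain r where "r \<in> {1..d}" "x \<in> P r"
        using cover by blast
      then show ?thesis
        using f g unfolding extensions_def by auto
    next
      case False
      then show ?thesis
        using f unfolding extensions_def g_def by (auto simp: PiE_def extensional_def)
    qed
  qed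
  ultimately have single: "extensions d V P = {g}"
    by blast
  have "fibre V g r = P r" if r: "r \<in> {1..d}" for r
  proof
    show "fibre V g r \<subseteq> P r"
    proof
      fix x assume "x \<in> fibre V g r"
      then have "x \<in> V" "g x = r"
        by (auto simp: fibre_def)
      then obtain s where "s \<in> {1..d}" "x \<in> P s"
        using cover by blast
      then show "x \<in> P r" using g \<open>g x = r\<close> by metis
    qed
    show "P r \<subseteq> fibre V g r"
      using "0.prems"(1)[OF r] g[OF r] by (auto simp: fibre_def)
  qed
  then have "block_weight d e X (fibre V g) = block_weight d e X P"
    by (rule block_weight_cong)
  then show ?case
    unfolding single by simp
next
  case (Suc c)
  then have "V - (\<Union>r\<in>{1..d}. P r) \<noteq> {}"
    by (metis card.empty nat.distinct(1))
  then obtain x where x: "x \<in> V" "\<And>r. r \<in> {1..d} \<Longrightarrow> x \<notin> P r"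
    by blast
  let ?Q = "\<lambda>r. P(r := insert x (P r))"
  have IH: "(\<Sum>f\<in>extensions d V (?Q r). block_weight d e X (fibre V f)) = block_weight d e X (?Q r)"
    if r: "r \<in> {1..d}" for r
  proof (rule Suc.hyps(1))
    have "(\<Union>s\<in>{1..d}. ?Q r s) = insert x (\<Union>s\<in>{1..d}. P s)"
      using r by (fastforce split: if_splits)
    then have "V - (\<Union>s\<in>{1..d}. ?Q r s) = (V - (\<Union>s\<in>{1..d}. P s)) - {x}"
      by blast
    then show "c = card (V - (\<Union>s\<in>{1..d}. ?Q r s))"
      using Suc.hyps(2) x by (simp add: card_Diff_singleton)
    show "?Q r s \<subseteq> V" if "s \<in> {1..d}" for s
      using Suc.prems(1)[OF that] x by auto
    show "disjoint_family_on (?Q r) {1..d}"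
      unfolding disjoint_family_on_def
    proof (intro ballI impI)
      fix s t assume st: "s \<in> {1..d}" "t \<in> {1..d}" "s \<noteq> t"
      then have "P s \<inter> P t = {}"
        using Suc.prems(2) unfolding disjoint_family_on_def by blast
      then show "?Q r s \<inter> ?Q r t = {}"
        using x(2)[OF st(1)] x(2)[OF st(2)] st(3) by auto
    qed
  qed
  have extend_iff: "f \<in> extensions d V (?Q r) \<longleftrightarrow> f \<in> extensions d V P \<and> f x = r"
    if r: "r \<in> {1..d}" for f r
  proof -
    have "(\<forall>y\<in>?Q r s. f y = s) \<longleftrightarrow> (\<forall>y\<in>P s. f y = s) \<and> (s = r \<longrightarrow> f x = r)" for s
      by auto
    then show ?thesis
      unfolding extensions_def mem_Collect_eq using r by metis
  qed
  have "f x \<in> {1..d}" if "f \<in> extensions d V P" for f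
    using PiE_mem[of f V "\<lambda>_. {1..d}" x] that x(1) unfolding extensions_def by blast
  then have split: "extensions d V P = (\<Union>r\<in>{1..d}. extensions d V (?Q r))"
    using extend_iff by blast
  have "(\<Sum>f\<in>extensions d V P. block_weight d e X (fibre V f))
      = (\<Sum>r=1..d. \<Sum>f\<in>extensions d V (?Q r). block_weight d e X (fibre V f))"
    unfolding split
  proof (intro sum.UNION_disjoint ballI impI)
    fix r s assume rs: "r \<in> {1..d}" "s \<in> {1..d}" "r \<noteq> s"
    show "extensions d V (?Q r) \<inter> extensions d V (?Q s) = {}"
      using extend_iff[OF rs(1)] extend_iff[OF rs(2)] rs(3) by auto
  qed (use \<open>finite V\<close> finite_extensions in auto)
  also have "\<dots> = (\<Sum>r=1..d. block_weight d e X (?Q r))"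
    using IH by (intro sum.cong) auto
  also have "\<dots> = block_weight d e X P"
  proof (rule sum_block_weight_insert[OF assms(1) X])
    show "finite (P r)" if "r \<in> {1..d}" for r
      using Suc.prems(1)[OF that] \<open>finite V\<close> by (rule finite_subset)
  qed (use x V in blast)+
  finally show ?case .
qed

lemma sum_block_weight_colourings:
  assumes "d \<ge> 1" and "disjoint_family_on X {1..e}"
    and "finite V" and "V \<subseteq> (\<Union>k\<in>{1..e}. X k)"
  shows "(\<Sum>f\<in>V \<rightarrow>\<^sub>E {1..d}. block_weight d e X (fibre V f)) = 1"
  using sum_block_weight_extensions[OF assms, of "\<lambda>_. {}"]
  by (simp add: extensions_empty block_weight_empty disjoint_family_on_def)

section \<open>The inequality\<close>

lemma extensions_disjoint:
  assumes "p \<in> {1..d}" "q \<in> {1..d}" "p \<noteq> q" "P p \<inter> Q q \<noteq> {}"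
  shows "extensions d V P \<inter> extensions d V Q = {}"
  using assms unfolding extensions_def by fastforce

lemma weak_bollobas_extensions_disjoint:
  assumes A: "weak_bollobas d n m A" and ij: "i \<in> {1..m}" "j \<in> {1..m}" "i \<noteq> j"
  shows "extensions d V (A i) \<inter> extensions d V (A j) = {}"
proof -
  have "extensions d V (A i) \<inter> extensions d V (A j) = {}"
    if ordered: "1 \<le> i" "i < j" "j \<le> m" for i j
  proof -
    obtain p q where "1 \<le> p" "p < q" "q \<le> d"
      and "A i p \<inter> A j q \<noteq> {} \<or> A j p \<inter> A i q \<noteq> {}"
      using A ordered unfolding weak_bollobas_def by blast
    then show ?thesis
      using extensions_disjoint[of p d q "A i" "A j" V] extensions_disjoint[of p d q "A j" "A i" V]
      by auto
  qed
  from this[of i j] this[of j i] ij show ?thesis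
    by (cases "i < j") auto
qed

lemma weak_bollobas_sum_block_weight_le_1:
  assumes "d \<ge> 1" and X: "disjoint_family_on X {1..e}" "(\<Union>k\<in>{1..e}. X k) = {1..n}"
    and A: "weak_bollobas d n m A"
  shows "(\<Sum>i=1..m. block_weight d e X (A i)) \<le> 1"
proof -
  let ?V = "{1..n}"
  have "(\<Sum>i=1..m. block_weight d e X (A i))
      = (\<Sum>i=1..m. \<Sum>f\<in>extensions d ?V (A i). block_weight d e X (fibre ?V f))"
  proof (intro sum.cong refl)
    fix i assume "i \<in> {1..m}"
    then have "d_partition d n (A i)"
      using A unfolding weak_bollobas_def by blast
    then show "block_weight d e X (A i)
        = (\<Sum>f\<in>extensions d ?V (A i). block_weight d e X (fibre ?V f))"
      using assms(1) X unfolding d_partition_def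
      by (intro sum_block_weight_extensions[symmetric]) auto
  qed
  also have "\<dots> = (\<Sum>f\<in>(\<Union>i\<in>{1..m}. extensions d ?V (A i)). block_weight d e X (fibre ?V f))"
    using weak_bollobas_extensions_disjoint[OF A] finite_extensions
    by (intro sum.UNION_disjoint[symmetric]) auto
  also have "\<dots> \<le> (\<Sum>f\<in>?V \<rightarrow>\<^sub>E {1..d}. block_weight d e X (fibre ?V f))"
    by (intro sum_mono2 block_weight_nonneg finite_PiE) (auto simp: extensions_def)
  also have "\<dots> = 1"
    by (intro sum_block_weight_colourings assms(1) X(1)) (simp_all only: X(2) finite_atLeastAtMost order_refl)
  finally show ?thesis .
qed

lemma d_partition_sum_card:
  assumes "d_partition d n P"
  shows "(\<Sum>r=1..d. card (P r \<inter> Y)) = card ((\<Union>r\<in>{1..d}. P r) \<inter> Y)"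
proof -
  have "card (\<Union>r\<in>{1..d}. P r \<inter> Y) = (\<Sum>r=1..d. card (P r \<inter> Y))"
  proof (intro card_UN_disjoint ballI impI)
    show "finite (P r \<inter> Y)" if "r \<in> {1..d}" for r
      using assms that unfolding d_partition_def by (blast intro: finite_subset)
    show "(P r \<inter> Y) \<inter> (P s \<inter> Y) = {}" if "r \<in> {1..d}" "s \<in> {1..d}" "r \<noteq> s" for r s
      using assms that unfolding d_partition_def disjoint_family_on_def by blast
  qed simp
  then show ?thesis by (simp add: Int_UN_distrib2)
qed

text \<open>
  The binomial factor of a tuple depends on how many points it covers in each block. Bounding that number
  by the size of the support in the block replaces it by one common factor.
\<close>

lemma weak_bollobas_inequality:
  fixes e :: nat
  assumes "d \<ge> 1" and X: "disjoint_family_on X {1..e}" "(\<Union>k\<in>{1..e}. X k) = {1..n}"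
    and A: "weak_bollobas d n m A"
  shows "(\<Sum>i=1..m. inverse (\<Prod>k=1..e.
           multinomial (\<Sum>r=1..d. card (A i r \<inter> X k)) d (\<lambda>r. card (A i r \<inter> X k))))
       \<le> real (\<Prod>k=1..e. (card (family_support d m A \<inter> X k) + d - 1) choose (d - 1))"
    (is "?L \<le> real ?B")
proof -
  have part: "d_partition d n (A i)" if "i \<in> {1..m}" for i
    using A that unfolding weak_bollobas_def by blast
  have "family_support d m A \<subseteq> {1..n}"
    using part unfolding family_support_def d_partition_def by blast
  then have fin: "finite (family_support d m A)"
    by (rule finite_subset) simp
  have size: "(\<Sum>r=1..d. card (A i r \<inter> X k)) \<le> card (family_support d m A \<inter> X k)"
    if "i \<in> {1..m}" for i k
    unfolding d_partition_sum_card[OF part[OF that]] using fin that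
    by (intro card_mono) (auto simp: family_support_def)
  have "?L \<le> (\<Sum>i=1..m. block_weight d e X (A i) * real ?B)"
    unfolding inverse_prod_multinomial_eq_block_weight[OF assms(1)] of_nat_prod
    using size
    by (intro sum_mono mult_left_mono prod_mono block_weight_nonneg)
       (auto intro!: binomial_right_mono diff_le_mono add_right_mono)
  also have "\<dots> = (\<Sum>i=1..m. block_weight d e X (A i)) * real ?B"
    by (simp add: sum_distrib_right)
  also have "\<dots> \<le> 1 * real ?B"
    using weak_bollobas_sum_block_weight_le_1[OF assms] by (intro mult_right_mono of_nat_0_le_iff)
  finally show ?thesis by simp
qed

section \<open>The system of all colourings\<close>

lemma d_partition_fibre: "d_partition d n (fibre {1..n} f)"
  unfolding d_partition_def fibre_def disjoint_family_on_def by auto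

lemma Union_fibre:
  assumes "f \<in> V \<rightarrow>\<^sub>E {1..d}"
  shows "(\<Union>r\<in>{1..d}. fibre V f r) = V"
  using assms by (fastforce simp: fibre_def dest: PiE_mem)

text \<open>
  Distinct colourings differ at a point, and its two colours, taken in increasing order, are the required
  indices \<open>p < q\<close>; the order decides which of the two intersections is nonempty.
\<close>

lemma weak_bollobas_fibres:
  assumes g: "\<And>i. i \<in> {1..m} \<Longrightarrow> g i \<in> {1..n} \<rightarrow>\<^sub>E {1..d}" and inj: "inj_on g {1..m}"
  shows "weak_bollobas d n m (\<lambda>i. fibre {1..n} (g i))"
  unfolding weak_bollobas_def
proof (intro conjI ballI allI impI)
  show "d_partition d n (fibre {1..n} (g i))" for i
    by (rule d_partition_fibre)
next
  fix i j assume ij: "1 \<le> i \<and> i < j \<and> j \<le> m"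
  then have "g i \<noteq> g j"
    using inj_onD[OF inj, of i j] by auto
  moreover have gi: "g i \<in> {1..n} \<rightarrow>\<^sub>E {1..d}" "g j \<in> {1..n} \<rightarrow>\<^sub>E {1..d}"
    using ij g by auto
  ultimately obtain x where x: "x \<in> {1..n}" "g i x \<noteq> g j x"
    using PiE_ext by blast
  have range: "g i x \<in> {1..d}" "g j x \<in> {1..d}"
    using x(1) gi by (blast dest: PiE_mem)+
  show "\<exists>p q. 1 \<le> p \<and> p < q \<and> q \<le> d \<and>
          (fibre {1..n} (g i) p \<inter> fibre {1..n} (g j) q \<noteq> {} \<or>
           fibre {1..n} (g j) p \<inter> fibre {1..n} (g i) q \<noteq> {})"
  proof (cases "g i x < g j x")
    case True
    then show ?thesis
      using x range by (intro exI[of _ "g i x"] exI[of _ "g j x"]) (auto simp: fibre_def)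
  next
    case False
    then show ?thesis
      using x range by (intro exI[of _ "g j x"] exI[of _ "g i x"]) (auto simp: fibre_def)
  qed
qed

lemma weak_bollobas_inequality_tight:
  fixes e :: nat
  assumes "d \<ge> 1" and X: "disjoint_family_on X {1..e}" "(\<Union>k\<in>{1..e}. X k) = {1..n}"
  shows "\<exists>m A. weak_bollobas d n m A \<and>
           (\<forall>k\<in>{1..e}. card (family_support d m A \<inter> X k) = card (X k)) \<and>
           (\<Sum>i=1..m. inverse (\<Prod>k=1..e.
              multinomial (\<Sum>r=1..d. card (A i r \<inter> X k)) d (\<lambda>r. card (A i r \<inter> X k))))
           = real (\<Prod>k=1..e. (card (family_support d m A \<inter> X k) + d - 1) choose (d - 1))"
proof -
  define F where "F = {1..n} \<rightarrow>\<^sub>E {1..d}"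
  have "finite F"
    unfolding F_def by (simp add: finite_PiE)
  define m where "m = card F"
  obtain g where g: "bij_betw g {1..m} F"
    using ex_bij_betw_nat_finite_1[OF \<open>finite F\<close>] unfolding m_def by blast
  then have gF: "g i \<in> F" if "i \<in> {1..m}" for i
    using that bij_betwE by blast
  define A where "A = (\<lambda>i. fibre {1..n} (g i))"
  have wb: "weak_bollobas d n m A"
    unfolding A_def using gF g
    by (intro weak_bollobas_fibres) (auto simp: F_def bij_betw_def)
  have "F \<noteq> {}"
    unfolding F_def using assms(1) by (auto simp: PiE_eq_empty_iff)
  then have "m \<ge> 1"
    unfolding m_def using \<open>finite F\<close> by (simp add: Suc_le_eq card_gt_0_iff)
  have cover: "(\<Union>r\<in>{1..d}. A i r) = {1..n}" if "i \<in> {1..m}" for i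
    unfolding A_def using gF[OF that] unfolding F_def by (rule Union_fibre)
  then have supp: "family_support d m A = {1..n}"
    unfolding family_support_def using \<open>m \<ge> 1\<close> by simp
  have block: "{1..n} \<inter> X k = X k" if "k \<in> {1..e}" for k
    using X(2) that by blast
  have size: "(\<Sum>r=1..d. card (A i r \<inter> X k)) = card (X k)" if "i \<in> {1..m}" "k \<in> {1..e}" for i k
    using d_partition_sum_card[OF d_partition_fibre[of d n "g i"], of "X k"] cover[OF that(1)] block[OF that(2)]
    unfolding A_def by simp
  let ?B = "\<Prod>k=1..e. (card (X k) + d - 1) choose (d - 1)"
  have "(\<Sum>i=1..m. inverse (\<Prod>k=1..e.
           multinomial (\<Sum>r=1..d. card (A i r \<inter> X k)) d (\<lambda>r. card (A i r \<inter> X k))))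
      = (\<Sum>i=1..m. block_weight d e X (A i) * real ?B)"
    unfolding inverse_prod_multinomial_eq_block_weight[OF assms(1)] of_nat_prod
    using size by (intro sum.cong arg_cong2[of _ _ _ _ "(*)"] prod.cong refl) auto
  also have "\<dots> = (\<Sum>i=1..m. block_weight d e X (A i)) * real ?B"
    by (simp add: sum_distrib_right)
  also have "(\<Sum>i=1..m. block_weight d e X (A i)) = (\<Sum>f\<in>F. block_weight d e X (fibre {1..n} f))"
    unfolding A_def by (rule sum.reindex_bij_betw[OF g])
  also have "\<dots> = 1"
    unfolding F_def by (intro sum_block_weight_colourings assms(1) X(1)) (simp_all only: X(2) finite_atLeastAtMost order_refl)
  finally have "(\<Sum>i=1..m. inverse (\<Prod>k=1..e.
           multinomial (\<Sum>r=1..d. card (A i r \<inter> X k)) d (\<lambda>r. card (A i r \<inter> X k)))) = real ?B"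
    by simp
  moreover have "?B = (\<Prod>k=1..e. (card (family_support d m A \<inter> X k) + d - 1) choose (d - 1))"
    unfolding supp using block by simp
  moreover have "\<forall>k\<in>{1..e}. card (family_support d m A \<inter> X k) = card (X k)"
    unfolding supp using block by simp
  ultimately show ?thesis
    using wb by (intro exI[of _ m] exI[of _ A]) simp
qed

theorem theorem1p13:
  fixes d e n :: nat and X :: "nat \<Rightarrow> nat set"
  assumes "d \<ge> 2" and "e \<ge> 1" and "n \<ge> 1"
    and "disjoint_family_on X {1..e}" and "(\<Union>k\<in>{1..e}. X k) = {1..n}"
  shows "(\<forall>m A. weak_bollobas d n m A \<longrightarrow>
            (\<Sum>i=1..m. inverse (\<Prod>k=1..e.
               multinomial (\<Sum>r=1..d. card (A i r \<inter> X k)) d (\<lambda>r. card (A i r \<inter> X k))))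
            \<le> real (\<Prod>k=1..e. (card (family_support d m A \<inter> X k) + d - 1) choose (d - 1)))
       \<and> (\<exists>m A. weak_bollobas d n m A \<and>
            (\<forall>k\<in>{1..e}. card (family_support d m A \<inter> X k) = card (X k)) \<and>
            (\<Sum>i=1..m. inverse (\<Prod>k=1..e.
               multinomial (\<Sum>r=1..d. card (A i r \<inter> X k)) d (\<lambda>r. card (A i r \<inter> X k))))
            = real (\<Prod>k=1..e. (card (family_support d m A \<inter> X k) + d - 1) choose (d - 1)))"
proof -
  have "d \<ge> 1" using assms(1) by simp
  then show ?thesis
    using weak_bollobas_inequality[OF _ assms(4,5)] weak_bollobas_inequality_tight[OF _ assms(4,5)]
    by blast
qed

end
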